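(* Let $Y$ be a nonempty compact metric space and let $S=\{(W,\mathcal W),(X,\mathcal X),u,P,\{\Gamma_x\}_{x\in X}\}$ be an RSCC on $Y$ such that $X$ is countable and discrete, $\mathcal X$ is the power set of $X$, $W$ is a metric space and $\mathcal W=\mathcal B(W)$. Then $S$ does not exhibit an emptiness jump in kernel Julia sets if one of the following conditions holds: (i) the state space $W$ is discrete (i.e. its metric topology is the discrete topology); (ii) the set $A:=\{w\in W: J_{\ker,w}(S)=\emptyset\}$ belongs to $\mathcal W$, and there exists a $\sigma$-finite measure $\varphi$ on $(W,\mathcal W)$ such that $S$ is $\varphi$-irreducible and $\varphi(A)>0$.
   Context: An RSCC is a quadruple $\{(W,\mathcal W),(X,\mathcal X),u,P\}$ where $(W,\mathcal W)$ (states) and $(X,\mathcal X)$ (indices) are measurable spaces, $u:W\times X\to W$ is measurable, and $P$ is a transition probability from $(W,\mathcal W)$ to $(X,\mathcal X)$. Write $wx:=u(w,x)$ and $wx^{(n)}:=(\cdots((wx_1)x_2)\cdots)x_n$ for $x^{(n)}=(x_1,\dots,x_n)\in X^n$, with $wx^{(0)}:=w$. For $w\in W$, $\mathbf P_w$ is the unique probability measure on $X^{\mathbb N}$ with $\mathbf P_w([x_1,\dots,x_n])=\prod_{k=1}^n P(wx^{(k-1)},\{x_k\})$; $X^{\mathbb N}$ carries the product topology, and $\operatorname{supp}$ denotes topological support. Countable means finite or countably infinite. $\mathrm{CM}(Y)$ is the space of continuous self-maps of $Y$. An RSCC on $Y$ is an RSCC together with a family $\{\Gamma_x\}_{x\in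 X}$ of nonempty subsets of $\mathrm{CM}(Y)$. $X_{w,n}:=\{x^{(n)}\in X^n:\mathbf P_w([x^{(n)}])>0\}$ and $\operatorname{Reach}(w):=\{wx^{(n)}: n\in\mathbb N,\ x^{(n)}\in X_{w,n}\}$, $\mathbb N=\{1,2,\dots\}$. $H_w(S):=\{\gamma_n\circ\cdots\circ\gamma_1: n\in\mathbb N,\ x^{(n)}\in X_{w,n},\ \gamma_j\in\Gamma_{x_j}\}$, and $H_w^v(S)$ is the subset of compositions arising from some such $x^{(n)}$ with $wx^{(n)}=v$. The Julia set at $w$ is $J_w(S):=\{y\in Y: H_w(S)\text{ is not equicontinuous on any neighborhood of }y\}$. The kernel Julia set at $w$ is $J_{\ker,w}(S):=\bigcap_{v\in\operatorname{Reach}(w)}\bigcap_{\gamma\in H_w^v(S)}\gamma^{-1}(J_v(S))$. Emptiness jump: $S$ exhibits an emptiness jump in kernel Julia sets if there exist $w_0\in W$, $(x_n)_{n\in\mathbb N}\in\operatorname{supp}(\mathbf P_{w_0})$ and $w_\infty\in W$ such that $w_n:=w_0x^{(n)}$ satisfies $d_W(w_n,w_\infty)\to0$, $J_{\ker,w_n}(S)=\emptyset$ for all $n\in\mathbb N$, and $J_{\ker,w_\infty}(S)\ne\emptyset$. $\varphi$-irreducibility: for $w\in W$ and $B\in\mathcal W$ let $L(w,B):=\mathbf P_w\bigl(\bigcup_{n\in\mathbb N}\{(x_k)_k\in X^{\mathbb N}: wx^{(n)}\in B\}\bigr)$. $S$ is $\varphi$-irreducible if $L(w,B)>0$ for all $w\in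 W$ and all $B\in\mathcal W$ with $\varphi(B)>0$. *)

theory Defs
  imports "HOL-Probability.Probability"
begin

text \<open>
  The measurable spaces \<open>W\<close> and \<open>X\<close> live on whole types, \<open>Y\<close> is a type as well.
  A sequence \<open>(x\<^sub>k)\<close> with \<open>k = 1, 2, \<dots>\<close> is a function \<open>\<omega>\<close> on \<^typ>\<open>nat\<close> with \<open>x\<^sub>k = \<omega> (k - 1)\<close>;
  a word \<open>(x\<^sub>1, \<dots>, x\<^sub>n)\<close> is a list of length \<open>n\<close>.
\<close>

record ('w, 'x, 'y) rscc =
  states :: "'w measure"
  indices :: "'x measure"
  step :: "'w \<Rightarrow> 'x \<Rightarrow> 'w"
  trans_prob :: "'w \<Rightarrow> 'x measure"
  maps :: "'x \<Rightarrow> ('y \<Rightarrow> 'y) set"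

text \<open>
  Measurability into \<^const>\<open>prob_algebra\<close> says that \<open>P(w, \<cdot>)\<close> is a probability measure for
  every \<open>w\<close> and \<open>P(\<cdot>, B)\<close> is measurable for every measurable \<open>B\<close>.
\<close>

definition is_rscc_on :: "('w, 'x, 'y::topological_space) rscc \<Rightarrow> bool" where
  "is_rscc_on S \<longleftrightarrow>
     space (states S) = UNIV \<and> space (indices S) = UNIV \<and>
     (\<lambda>(w, x). step S w x) \<in> states S \<Otimes>\<^sub>M indices S \<rightarrow>\<^sub>M states S \<and>
     trans_prob S \<in> states S \<rightarrow>\<^sub>M prob_algebra (indices S) \<and>
     (\<forall>x. maps S x \<noteq> {} \<and> maps S x \<subseteq> {g. continuous_on UNIV g})"

definition act :: "('w, 'x, 'y) rscc \<Rightarrow> 'w \<Rightarrow> 'x list \<Rightarrow> 'w" where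
  "act S w xs = foldl (step S) w xs"

definition initial :: "nat \<Rightarrow> (nat \<Rightarrow> 'x) \<Rightarrow> 'x list" where
  "initial n \<omega> = map \<omega> [0..<n]"

definition cylinder :: "'x list \<Rightarrow> (nat \<Rightarrow> 'x) set" where
  "cylinder xs = {\<omega>. initial (length xs) \<omega> = xs}"

definition is_path_measure :: "('w, 'x, 'y) rscc \<Rightarrow> 'w \<Rightarrow> (nat \<Rightarrow> 'x) measure \<Rightarrow> bool" where
  "is_path_measure S w M \<longleftrightarrow>
     prob_space M \<and> sets M = sets (\<Pi>\<^sub>M k\<in>UNIV. indices S) \<and>
     (\<forall>xs. emeasure M (cylinder xs) =
        (\<Prod>k<length xs. emeasure (trans_prob S (act S w (take k xs))) {xs ! k}))"

definition path_measure :: "('w, 'x, 'y) rscc \<Rightarrow> 'w \<Rightarrow> (nat \<Rightarrow> 'x) measure" where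
  "path_measure S w = (THE M. is_path_measure S w M)"

text \<open>
  Meaningful when every open set belongs to \<^term>\<open>sets M\<close> (\<^const>\<open>emeasure\<close> is \<open>0\<close> on
  other sets); see \<open>open_in_sets_path_space\<close> below.
\<close>

definition topological_support :: "'a::topological_space measure \<Rightarrow> 'a set" where
  "topological_support M = {x. \<forall>U. open U \<and> x \<in> U \<longrightarrow> emeasure M U > 0}"

definition admissible_words :: "('w, 'x, 'y) rscc \<Rightarrow> 'w \<Rightarrow> nat \<Rightarrow> 'x list set" where
  "admissible_words S w n = {xs. length xs = n \<and> emeasure (path_measure S w) (cylinder xs) > 0}"

definition Reach :: "('w, 'x, 'y) rscc \<Rightarrow> 'w \<Rightarrow> 'w set" where
  "Reach S w = {act S w xs | xs n. n \<ge> 1 \<and> xs \<in> admissible_words S w n}"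

text \<open>\<open>fold (\<circ>) [\<gamma>\<^sub>1, \<dots>, \<gamma>\<^sub>n] id\<close> is \<open>\<gamma>\<^sub>n \<circ> \<dots> \<circ> \<gamma>\<^sub>1\<close>.\<close>

definition word_maps :: "('w, 'x, 'y) rscc \<Rightarrow> 'x list \<Rightarrow> ('y \<Rightarrow> 'y) set" where
  "word_maps S xs = {fold (\<circ>) gs id | gs. list_all2 (\<lambda>g x. g \<in> maps S x) gs xs}"

definition H_maps :: "('w, 'x, 'y) rscc \<Rightarrow> 'w \<Rightarrow> ('y \<Rightarrow> 'y) set" where
  "H_maps S w = {h. \<exists>n\<ge>1. \<exists>xs \<in> admissible_words S w n. h \<in> word_maps S xs}"

definition H_maps_to :: "('w, 'x, 'y) rscc \<Rightarrow> 'w \<Rightarrow> 'w \<Rightarrow> ('y \<Rightarrow> 'y) set" where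
  "H_maps_to S w v =
     {h. \<exists>n\<ge>1. \<exists>xs \<in> admissible_words S w n. act S w xs = v \<and> h \<in> word_maps S xs}"

definition equicontinuous_on :: "'a::metric_space set \<Rightarrow> ('a \<Rightarrow> 'b::metric_space) set \<Rightarrow> bool" where
  "equicontinuous_on U F \<longleftrightarrow>
     (\<forall>z\<in>U. \<forall>e>0. \<exists>d>0. \<forall>f\<in>F. \<forall>z'\<in>U. dist z' z < d \<longrightarrow> dist (f z') (f z) < e)"

definition Julia :: "('w, 'x, 'y::metric_space) rscc \<Rightarrow> 'w \<Rightarrow> 'y set" where
  "Julia S w = {y. \<forall>U. y \<in> interior U \<longrightarrow> \<not> equicontinuous_on U (H_maps S w)}"

definition kernel_Julia :: "('w, 'x, 'y::metric_space) rscc \<Rightarrow> 'w \<Rightarrow> 'y set" where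
  "kernel_Julia S w = (\<Inter>v \<in> Reach S w. \<Inter>\<gamma> \<in> H_maps_to S w v. \<gamma> -` Julia S v)"

definition emptiness_jump ::
    "('w::metric_space, 'x::topological_space, 'y::metric_space) rscc \<Rightarrow> bool" where
  "emptiness_jump S \<longleftrightarrow>
     (\<exists>w\<^sub>0. \<exists>\<omega> \<in> topological_support (path_measure S w\<^sub>0). \<exists>v.
        (\<lambda>n. act S w\<^sub>0 (initial n \<omega>)) \<longlonglongrightarrow> v \<and>
        (\<forall>n\<ge>1. kernel_Julia S (act S w\<^sub>0 (initial n \<omega>)) = {}) \<and>
        kernel_Julia S v \<noteq> {})"

definition hitting_prob :: "('w, 'x, 'y) rscc \<Rightarrow> 'w \<Rightarrow> 'w set \<Rightarrow> ennreal" where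
  "hitting_prob S w B =
     emeasure (path_measure S w) (\<Union>n\<in>{1..}. {\<omega>. act S w (initial n \<omega>) \<in> B})"

definition irreducible_wrt :: "'w measure \<Rightarrow> ('w, 'x, 'y) rscc \<Rightarrow> bool" where
  "irreducible_wrt \<phi> S \<longleftrightarrow>
     (\<forall>w. \<forall>B \<in> sets (states S). emeasure \<phi> B > 0 \<longrightarrow> hitting_prob S w B > 0)"


subsection \<open>Well-definedness of the path measure\<close>

lemma initial_Suc: "initial (Suc n) \<omega> = initial n \<omega> @ [\<omega> n]"
  by (simp add: initial_def)

lemma length_initial [simp]: "length (initial n \<omega>) = n"
  by (simp add: initial_def)

lemma initial_eq_iff: "length xs = n \<Longrightarrow> initial n \<omega> = xs \<longleftrightarrow> (\<forall>k<n. \<omega> k = xs ! k)"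
  by (auto simp: initial_def list_eq_iff_nth_eq)

lemma initial_nth: "k \<le> length xs \<Longrightarrow> initial k (\<lambda>i. xs ! i) = take k xs"
  by (simp add: list_eq_iff_nth_eq) (simp add: initial_def)

lemma open_imp_cylinder:
  fixes U :: "(nat \<Rightarrow> 'x::topological_space) set"
  assumes "open U" "\<omega> \<in> U"
  shows "\<exists>n. cylinder (initial n \<omega>) \<subseteq> U"
proof -
  obtain A where A: "\<omega> \<in> Pi\<^sub>E UNIV A" "finite {i. A i \<noteq> UNIV}" "Pi\<^sub>E UNIV A \<subseteq> U"
    using product_topology_open_contains_basis[of "\<lambda>_. euclidean" UNIV U \<omega>] assms
    by (auto simp: open_fun_def)
  obtain n where n: "\<forall>i\<in>{i. A i \<noteq> UNIV}. i < n"
    using A(2) finite_nat_set_iff_bounded by blast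
  have "cylinder (initial n \<omega>) \<subseteq> Pi\<^sub>E UNIV A"
  proof
    fix \<eta> assume "\<eta> \<in> cylinder (initial n \<omega>)"
    then have eq: "\<eta> k = \<omega> k" if "k < n" for k
      using that by (simp add: cylinder_def initial_eq_iff) (simp add: initial_def)
    have "\<eta> i \<in> A i" for i
      using A(1) n eq[of i] by (cases "A i = UNIV") (auto simp: PiE_iff)
    then show "\<eta> \<in> Pi\<^sub>E UNIV A" by (auto simp: PiE_iff)
  qed
  with A(3) show ?thesis by blast
qed

lemma cylinder_eq_prod_emb:
  assumes "space M = UNIV"
  shows "cylinder xs =
    prod_emb UNIV (\<lambda>_. M) {0..<length xs} (Pi\<^sub>E {0..<length xs} (\<lambda>k. {xs ! k}))"
  using assms by (subst prod_emb_PiE) (auto simp: cylinder_def initial_eq_iff PiE_iff split: if_splits)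

lemma cylinder_in_sets:
  assumes "sets M = Pow UNIV"
  shows "cylinder xs \<in> sets (\<Pi>\<^sub>M k\<in>UNIV. M)"
proof -
  have "space M = UNIV" using sets_eq_imp_space_eq[of M "count_space UNIV"] assms by simp
  then show ?thesis
    by (subst cylinder_eq_prod_emb) (auto intro!: sets_PiM_I simp: assms)
qed

lemma open_in_sets_path_space:
  fixes U :: "(nat \<Rightarrow> 'x::{countable, topological_space}) set"
  assumes "sets M = Pow UNIV" "open U"
  shows "U \<in> sets (\<Pi>\<^sub>M k\<in>UNIV. M)"
proof -
  have "U = (\<Union>xs\<in>{xs. cylinder xs \<subseteq> U}. cylinder xs)"
  proof (intro equalityI subsetI)
    fix \<omega> assume "\<omega> \<in> U"
    from open_imp_cylinder[OF assms(2) this] obtain n where "cylinder (initial n \<omega>) \<subseteq> U" ..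
    moreover have "\<omega> \<in> cylinder (initial n \<omega>)" by (simp add: cylinder_def)
    ultimately show "\<omega> \<in> (\<Union>xs\<in>{xs. cylinder xs \<subseteq> U}. cylinder xs)" by blast
  qed auto
  also have "\<dots> \<in> sets (\<Pi>\<^sub>M k\<in>UNIV. M)"
    by (intro sets.countable_UN'') (auto intro: cylinder_in_sets[OF assms(1)])
  finally show ?thesis .
qed

lemma act_Nil [simp]: "act S w [] = w"
  by (simp add: act_def)

lemma act_snoc: "act S w (xs @ [x]) = step S (act S w xs) x"
  by (simp add: act_def)

lemma is_path_measure_unique:
  fixes S :: "('w, 'x::countable, 'y) rscc"
  assumes X: "sets (indices S) = Pow UNIV"
    and M: "is_path_measure S w M" and N: "is_path_measure S w N"
  shows "M = N"
proof (rule measure_eqI_PiM_infinite)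
  have sp: "space (indices S) = UNIV"
    using sets_eq_imp_space_eq[of "indices S" "count_space UNIV"] X by simp
  show M': "sets M = sets (\<Pi>\<^sub>M k\<in>UNIV. indices S)" and N': "sets N = sets (\<Pi>\<^sub>M k\<in>UNIV. indices S)"
    using M N by (auto simp: is_path_measure_def)
  show "finite_measure M"
    using M by (auto simp: is_path_measure_def prob_space_def)
  fix J :: "nat set" and A
  assume J: "finite J"
  obtain n where n: "\<forall>i\<in>J. i < n"
    using J finite_nat_set_iff_bounded by blast
  let ?E = "prod_emb UNIV (\<lambda>_. indices S) J (Pi\<^sub>E J A)"
  define I where "I = {xs. length xs = n \<and> (\<forall>i\<in>J. xs ! i \<in> A i)}"
  have E: "?E = (\<Union>xs\<in>I. cylinder xs)"
  proof (intro equalityI subsetI)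
    fix \<omega> assume "\<omega> \<in> ?E"
    then have "\<forall>i\<in>J. \<omega> i \<in> A i"
      by (auto simp: prod_emb_def PiE_iff)
    then have "initial n \<omega> \<in> I" "\<omega> \<in> cylinder (initial n \<omega>)"
      using n by (auto simp: I_def cylinder_def initial_def)
    then show "\<omega> \<in> (\<Union>xs\<in>I. cylinder xs)" by blast
  next
    fix \<omega> assume "\<omega> \<in> (\<Union>xs\<in>I. cylinder xs)"
    then show "\<omega> \<in> ?E"
      using n sp by (auto simp: I_def cylinder_def initial_eq_iff prod_emb_def PiE_iff)
  qed
  have dj: "disjoint_family_on cylinder I"
    by (auto simp: disjoint_family_on_def I_def cylinder_def)
  have "emeasure L ?E = (\<integral>\<^sup>+xs. (\<Prod>k<length xs. emeasure (trans_prob S (act S w (take k xs))) {xs ! k})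
      \<partial>count_space I)" if L: "is_path_measure S w L" for L
  proof -
    have "sets L = sets (\<Pi>\<^sub>M k\<in>UNIV. indices S)"
      using L by (simp add: is_path_measure_def)
    then have "emeasure L ?E = (\<integral>\<^sup>+xs. emeasure L (cylinder xs) \<partial>count_space I)"
      unfolding E using cylinder_in_sets[OF X] dj by (intro emeasure_UN_countable) auto
    then show ?thesis
      using L by (simp add: is_path_measure_def)
  qed
  from this[OF M] this[OF N] show "emeasure M ?E = emeasure N ?E" by simp
qed

lemma is_path_measure_exists:
  fixes S :: "('w, 'x::countable, 'y::topological_space) rscc"
  assumes S: "is_rscc_on S" and X: "sets (indices S) = Pow UNIV"
  shows "\<exists>M. is_path_measure S w M"
proof -
  let ?X = "\<lambda>_::nat. indices S"
  define K where "K = (\<lambda>i \<omega>. trans_prob S (act S w (initial i \<omega>)))"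
  have spW: "space (states S) = UNIV" and spX: "space (indices S) = UNIV"
    and u[measurable]: "(\<lambda>(w, x). step S w x) \<in> states S \<Otimes>\<^sub>M indices S \<rightarrow>\<^sub>M states S"
    and P[measurable]: "trans_prob S \<in> states S \<rightarrow>\<^sub>M prob_algebra (indices S)"
    using S by (auto simp: is_rscc_on_def)
  have act: "(\<lambda>\<omega>. act S w (initial j \<omega>)) \<in> PiM {0..<i} ?X \<rightarrow>\<^sub>M states S" if "j \<le> i" for i j
    using that
  proof (induction j)
    case 0
    then show ?case by (simp add: initial_def spW)
  next
    case (Suc j)
    have "(\<lambda>\<omega>. (act S w (initial j \<omega>), \<omega> j)) \<in> PiM {0..<i} ?X \<rightarrow>\<^sub>M states S \<Otimes>\<^sub>M indices S"
      using Suc by (intro measurable_Pair measurable_component_singleton) auto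
    from measurable_compose[OF this u] show ?case
      by (simp add: initial_Suc act_snoc)
  qed
  have K: "K i \<in> PiM {0..<i} ?X \<rightarrow>\<^sub>M prob_algebra (indices S)" for i
    unfolding K_def by (rule measurable_compose[OF act P]) simp
  interpret IT: Ionescu_Tulcea K ?X
  proof (rule Ionescu_Tulcea.intro)
    show "K i \<in> PiM {0..<i} ?X \<rightarrow>\<^sub>M subprob_algebra (indices S)" for i
      using K by (rule measurable_prob_algebraD)
    fix i x assume "x \<in> space (PiM {0..<i} ?X)"
    from measurable_space[OF K this] show "prob_space (K i x)"
      by (simp add: space_prob_algebra)
  qed
  let ?r = "\<lambda>\<omega> n. restrict \<omega> {0..<n}"
  have r_space: "?r \<omega> n \<in> space (PiM {0..<n} ?X)" for \<omega> n
    by (auto simp: space_PiM spX)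
  have r_sets: "{?r \<omega> n} \<in> sets (PiM {0..<n} ?X)" for \<omega> n
  proof -
    have "{?r \<omega> n} = Pi\<^sub>E {0..<n} (\<lambda>k. {\<omega> k})"
      by (auto simp: PiE_iff extensional_def fun_eq_iff)
    also have "\<dots> \<in> sets (PiM {0..<n} ?X)"
      by (intro sets_PiM_I_finite) (auto simp: X)
    finally show ?thesis .
  qed
  have C: "emeasure (IT.C 0 n (\<lambda>_. undefined)) {?r \<omega> n} = (\<Prod>k<n. emeasure (K k \<omega>) {\<omega> k})" for n \<omega>
  proof (induction n)
    case 0
    show ?case by (simp add: space_PiM emeasure_return restrict_def PiM_empty)
  next
    case (Suc n)
    have K_r: "K n (?r \<omega> n) = K n \<omega>"
      unfolding K_def by (rule arg_cong[where f="\<lambda>xs. trans_prob S (act S w xs)"]) (simp add: initial_def)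
    have eP: "emeasure (IT.eP n x) {?r \<omega> (Suc n)} = emeasure (K n \<omega>) {\<omega> n} * indicator {?r \<omega> n} x"
      if x: "x \<in> space (PiM {0..<n} ?X)" for x
    proof -
      have ext: "x \<in> extensional {0..<n}"
        using x by (auto simp: space_PiM PiE_iff)
      have "(\<lambda>y. x(n := y)) -` {?r \<omega> (Suc n)} \<inter> space (indices S) = (if x = ?r \<omega> n then {\<omega> n} else {})"
        (is "?L = ?R")
      proof (rule set_eqI)
        fix y
        have "x(n := y) = ?r \<omega> (Suc n) \<longleftrightarrow> x = ?r \<omega> n \<and> y = \<omega> n"
        proof
          assume eq: "x(n := y) = ?r \<omega> (Suc n)"
          have "x i = ?r \<omega> n i" for i
            using fun_cong[OF eq, of i] ext by (cases "i < n") (auto simp: extensional_def)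
          with fun_cong[OF eq, of n] show "x = ?r \<omega> n \<and> y = \<omega> n" by auto
        qed (auto simp: fun_eq_iff)
        then show "y \<in> ?L \<longleftrightarrow> y \<in> ?R" by (auto simp: spX)
      qed
      then show ?thesis
        using IT.emeasure_eP[OF x r_sets, of \<omega>] K_r by (auto simp: indicator_def)
    qed
    have ne: "space (IT.C 0 n (\<lambda>_. undefined)) \<noteq> {}"
      using r_space by (auto simp: IT.space_C)
    have "emeasure (IT.C 0 (Suc n) (\<lambda>_. undefined)) {?r \<omega> (Suc n)} =
        (\<integral>\<^sup>+x. emeasure (IT.eP n x) {?r \<omega> (Suc n)} \<partial>IT.C 0 n (\<lambda>_. undefined))"
    proof -
      have "IT.eP n \<in> IT.C 0 n (\<lambda>_. undefined) \<rightarrow>\<^sub>M subprob_algebra (PiM {0..<Suc n} ?X)"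
        using IT.measurable_eP[of n] by (subst measurable_cong_sets[OF IT.sets_C refl]) auto
      from emeasure_bind[OF ne this r_sets] show ?thesis by simp
    qed
    also have "\<dots> = (\<integral>\<^sup>+x. emeasure (K n \<omega>) {\<omega> n} * indicator {?r \<omega> n} x \<partial>IT.C 0 n (\<lambda>_. undefined))"
      by (intro nn_integral_cong eP) (simp add: IT.space_C)
    also have "\<dots> = emeasure (K n \<omega>) {\<omega> n} * emeasure (IT.C 0 n (\<lambda>_. undefined)) {?r \<omega> n}"
      by (intro nn_integral_cmult_indicator) (simp add: IT.sets_C r_sets)
    finally show ?case
      by (simp add: Suc.IH mult.commute del: restrict_apply IT.C.simps)
  qed
  have "emeasure IT.PF.lim (cylinder xs) =
      (\<Prod>k<length xs. emeasure (trans_prob S (act S w (take k xs))) {xs ! k})" for xs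
  proof -
    let ?n = "length xs" and ?\<omega> = "\<lambda>k. xs ! k"
    have PiE_r: "Pi\<^sub>E {0..<?n} (\<lambda>k. {xs ! k}) = {?r ?\<omega> ?n}"
      by (auto simp: PiE_iff extensional_def fun_eq_iff)
    have "emeasure IT.PF.lim (cylinder xs) = emeasure (IT.CI {0..<?n}) {?r ?\<omega> ?n}"
      by (simp only: cylinder_eq_prod_emb[OF spX] PiE_r) (rule IT.lim[OF _ r_sets], simp)
    also have "\<dots> = emeasure (IT.C 0 ?n (\<lambda>_. undefined)) {?r ?\<omega> ?n}"
      using IT.emeasure_CI[OF order_refl r_sets] sets.sets_into_space[OF r_sets[of ?\<omega> ?n]]
      by (simp add: prod_emb_id space_PiM)
    also have "\<dots> = (\<Prod>k<?n. emeasure (trans_prob S (act S w (take k xs))) {xs ! k})"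
      by (subst C, intro prod.cong refl) (simp add: K_def initial_nth)
    finally show ?thesis .
  qed
  moreover from this[of "[]"] have "prob_space IT.PF.lim"
    by (intro prob_spaceI) (simp add: cylinder_def initial_def space_PiM spX)
  ultimately have "is_path_measure S w IT.PF.lim"
    by (simp add: is_path_measure_def IT.PF.sets_lim)
  then show ?thesis ..
qed

lemma is_path_measure_path_measure:
  fixes S :: "('w, 'x::countable, 'y::topological_space) rscc"
  assumes "is_rscc_on S" "sets (indices S) = Pow UNIV"
  shows "is_path_measure S w (path_measure S w)"
  unfolding path_measure_def
  using is_path_measure_exists[OF assms] is_path_measure_unique[OF assms(2)] by (metis theI)

end

(* Kernel Julia sets are forward invariant: a composition of maps along an admissible word from w
   to v sends J_ker,w into J_ker,v. Hence J_ker,w is empty as soon as J_ker,v is empty for some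
   reachable v. Under (ii) every state reaches A, so all kernel Julia sets are empty;
   under (i) the convergent sequence of states is eventually equal to its limit. *)
theory Submission
  imports Defs
begin

lemma act_append: "act S w (xs @ ys) = act S (act S w xs) ys"
  by (simp add: act_def)

text \<open>The accumulator \<open>f\<close> is applied first, so it splits off on the right. With
  \<open>f\<close> the composition along one word, this turns folding over an appended list into
  composition.\<close>

lemma fold_comp_conv:
  fixes f :: "'a \<Rightarrow> 'a"
  shows "fold (\<circ>) gs f = fold (\<circ>) gs id \<circ> f"
proof (induction gs arbitrary: f)
  case (Cons g gs)
  show ?case
    using Cons.IH[of "g \<circ> f"] Cons.IH[of g] by (simp add: comp_assoc)
qed simp

lemma word_maps_append:
  assumes "f \<in> word_maps S xs" "g \<in> word_maps S ys"
  shows "g \<circ> f \<in> word_maps S (xs @ ys)"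
proof -
  obtain fs gs
    where fs: "f = fold (\<circ>) fs id" "list_all2 (\<lambda>g x. g \<in> maps S x) fs xs"
      and gs: "g = fold (\<circ>) gs id" "list_all2 (\<lambda>g x. g \<in> maps S x) gs ys"
    using assms by (auto simp: word_maps_def)
  have "g \<circ> f = fold (\<circ>) (fs @ gs) id"
    using fold_comp_conv[of gs f] by (simp add: fs(1) gs(1))
  then show ?thesis
    using fs(2) gs(2) by (auto simp: word_maps_def intro!: list_all2_appendI exI[of _ "fs @ gs"])
qed

lemma word_maps_nonempty:
  assumes "\<And>x. maps S x \<noteq> {}"
  shows "word_maps S xs \<noteq> {}"
proof -
  have "list_all2 (\<lambda>g x. g \<in> maps S x) (map (\<lambda>x. SOME g. g \<in> maps S x) xs) xs"
    using assms by (auto simp: list_all2_conv_all_nth some_in_eq)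
  then show ?thesis
    by (auto simp: word_maps_def)
qed

context
  fixes S :: "('w, 'x::countable, 'y::metric_space) rscc"
  assumes S: "is_rscc_on S" and X: "sets (indices S) = Pow UNIV"
begin

lemma emeasure_cylinder:
  "emeasure (path_measure S w) (cylinder xs) =
    (\<Prod>k<length xs. emeasure (trans_prob S (act S w (take k xs))) {xs ! k})"
  using is_path_measure_path_measure[OF S X, of w] by (simp add: is_path_measure_def)

text \<open>Markov property: each transition factor depends only on the current state, and after
  \<open>xs\<close> the states along \<open>ys\<close> are those of the process started at
  \<open>act S w xs\<close>. Induction runs from the right because appending a letter adds exactly
  one factor, taken at the state reached so far.\<close>

lemma emeasure_cylinder_append:
  "emeasure (path_measure S w) (cylinder (xs @ ys)) =
    emeasure (path_measure S w) (cylinder xs) *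
    emeasure (path_measure S (act S w xs)) (cylinder ys)"
proof (induction ys rule: rev_induct)
  case Nil
  show ?case by (simp add: emeasure_cylinder)
next
  case (snoc y ys)
  have snoc_eq: "emeasure (path_measure S v) (cylinder (zs @ [y])) =
      emeasure (path_measure S v) (cylinder zs) * emeasure (trans_prob S (act S v zs)) {y}" for v zs
    by (simp add: emeasure_cylinder nth_append)
  show ?case
    using snoc_eq[of w "xs @ ys"] snoc_eq[of "act S w xs" ys] snoc.IH
    by (simp add: act_append mult.assoc)
qed

lemma admissible_words_append:
  assumes "xs \<in> admissible_words S w m" "ys \<in> admissible_words S (act S w xs) n"
  shows "xs @ ys \<in> admissible_words S w (m + n)"
  using assms by (auto simp: admissible_words_def emeasure_cylinder_append ennreal_zero_less_mult_iff)

lemma H_maps_to_comp: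
  assumes "f \<in> H_maps_to S w v" "g \<in> H_maps_to S v v'"
  shows "g \<circ> f \<in> H_maps_to S w v'"
proof -
  obtain m xs where xs: "m \<ge> 1" "xs \<in> admissible_words S w m" "act S w xs = v" "f \<in> word_maps S xs"
    using assms(1) by (auto simp: H_maps_to_def)
  obtain n ys where ys: "ys \<in> admissible_words S v n" "act S v ys = v'" "g \<in> word_maps S ys"
    using assms(2) by (auto simp: H_maps_to_def)
  have "xs @ ys \<in> admissible_words S w (m + n)"
    using admissible_words_append xs ys by blast
  moreover have "act S w (xs @ ys) = v'"
    by (simp add: act_append xs ys)
  ultimately show ?thesis
    using xs(1) word_maps_append[OF xs(4) ys(3)] unfolding H_maps_to_def
    by (intro CollectI exI[of _ "m + n"]) auto
qed

text \<open>Any element of \<open>H_maps_to S w v\<close> comes from an admissible word witnessing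
  that \<open>v\<close> is reachable, so the intersection may range over all states.\<close>

lemma kernel_Julia_eq: "kernel_Julia S w = {y. \<forall>v. \<forall>f\<in>H_maps_to S w v. f y \<in> Julia S v}"
proof -
  have "v \<in> Reach S w" if "f \<in> H_maps_to S w v" for f v
    using that by (auto simp: H_maps_to_def Reach_def)
  then show ?thesis
    by (auto simp: kernel_Julia_def)
qed

text \<open>Testing \<open>f y\<close> with a composition \<open>g\<close> issuing from
  \<open>v\<close> amounts to testing \<open>y\<close> with \<open>g \<circ> f\<close>, which issues
  from \<open>w\<close>.\<close>

lemma kernel_Julia_forward_invariant:
  assumes "f \<in> H_maps_to S w v" "y \<in> kernel_Julia S w"
  shows "f y \<in> kernel_Julia S v"
  unfolding kernel_Julia_eq
proof (intro CollectI allI ballI)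
  fix v' g
  assume "g \<in> H_maps_to S v v'"
  then have "(g \<circ> f) y \<in> Julia S v'"
    using assms(2) H_maps_to_comp[OF assms(1)] unfolding kernel_Julia_eq by blast
  then show "g (f y) \<in> Julia S v'" by simp
qed

text \<open>Since every \<open>maps S x\<close> is nonempty, some composition really leads from
  \<open>w\<close> to \<open>v\<close>; it would carry a point of the kernel Julia set at
  \<open>w\<close> into the empty set.\<close>

lemma kernel_Julia_empty_if_reaches_empty:
  assumes "v \<in> Reach S w" "kernel_Julia S v = {}"
  shows "kernel_Julia S w = {}"
proof -
  obtain n xs where xs: "n \<ge> 1" "xs \<in> admissible_words S w n" "act S w xs = v"
    using assms(1) by (auto simp: Reach_def)
  have "word_maps S xs \<noteq> {}"
    using S by (intro word_maps_nonempty) (simp add: is_rscc_on_def)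
  then obtain f where "f \<in> H_maps_to S w v"
    using xs by (auto simp: H_maps_to_def)
  then show ?thesis
    using kernel_Julia_forward_invariant assms(2) by blast
qed

text \<open>The hitting event is a countable union of cylinders over words ending in
  \<open>B\<close>. If no such word were admissible, the event would be null.\<close>

lemma Reach_if_hitting_prob_pos:
  assumes "hitting_prob S w B > 0"
  shows "\<exists>v\<in>B. v \<in> Reach S w"
proof (rule ccontr)
  assume not_reach: "\<not> ?thesis"
  \<comment> \<open>These cylinders may overlap, as one path can visit \<open>B\<close> several
    times; null sets only require countable subadditivity.\<close>
  define I where "I = {xs. length xs \<ge> 1 \<and> act S w xs \<in> B}"
  have sets: "cylinder xs \<in> sets (path_measure S w)" for xs
    using is_path_measure_path_measure[OF S X, of w] cylinder_in_sets[OF X, of xs]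
    by (simp add: is_path_measure_def)
  have "emeasure (path_measure S w) (cylinder xs) = 0" if "xs \<in> I" for xs
  proof (rule ccontr)
    assume "emeasure (path_measure S w) (cylinder xs) \<noteq> 0"
    then have "xs \<in> admissible_words S w (length xs)"
      by (simp add: admissible_words_def zero_less_iff_neq_zero)
    then have "act S w xs \<in> Reach S w"
      using that unfolding Reach_def I_def by blast
    with that not_reach show False
      by (auto simp: I_def)
  qed
  \<comment> \<open>\<open>I\<close> is countable because it consists of finite words over a
    countable alphabet.\<close>
  then have "(\<Union>xs\<in>I. cylinder xs) \<in> null_sets (path_measure S w)"
    using sets by (intro null_sets_UN') auto
  moreover have "(\<Union>n\<in>{1..}. {\<omega>. act S w (initial n \<omega>) \<in> B}) = (\<Union>xs\<in>I. cylinder xs)"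
  proof (intro equalityI subsetI)
    fix \<omega> assume "\<omega> \<in> (\<Union>n\<in>{1..}. {\<omega>. act S w (initial n \<omega>) \<in> B})"
    then obtain n where "n \<ge> 1" "act S w (initial n \<omega>) \<in> B" by auto
    then have "initial n \<omega> \<in> I" "\<omega> \<in> cylinder (initial n \<omega>)"
      by (simp_all add: I_def cylinder_def)
    then show "\<omega> \<in> (\<Union>xs\<in>I. cylinder xs)" by blast
  next
    fix \<omega> assume "\<omega> \<in> (\<Union>xs\<in>I. cylinder xs)"
    then obtain xs where "xs \<in> I" "initial (length xs) \<omega> = xs"
      by (auto simp: cylinder_def)
    then have "length xs \<in> {1..}" "act S w (initial (length xs) \<omega>) \<in> B"
      by (simp_all add: I_def)
    then show "\<omega> \<in> (\<Union>n\<in>{1..}. {\<omega>. act S w (initial n \<omega>) \<in> B})" by blast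
  qed
  ultimately have "hitting_prob S w B = 0"
    by (simp add: hitting_prob_def null_setsD1)
  with assms show False by simp
qed

end

text \<open>The singleton \<open>{l}\<close> is itself a neighborhood of the limit, so the sequence
  eventually stays inside it.\<close>

lemma eventually_eq_limit_if_discrete:
  fixes f :: "nat \<Rightarrow> 'a::topological_space"
  assumes "f \<longlonglongrightarrow> l" "open {l}"
  shows "\<forall>\<^sub>F n in sequentially. f n = l"
  using topological_tendstoD[OF assms] by simp

theorem mainTheorem3:
  fixes S :: "('w::metric_space, 'x::{countable, discrete_topology}, 'y::metric_space) rscc"
  assumes "compact (UNIV :: 'y set)"
    and "is_rscc_on S"
    and "sets (indices S) = Pow UNIV"
    and "sets (states S) = sets borel"
    and "(\<forall>U :: 'w set. open U) \<or>
         ({w. kernel_Julia S w = {}} \<in> sets (states S) \<and>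
          (\<exists>\<phi>. sets \<phi> = sets (states S) \<and> sigma_finite_measure \<phi> \<and> irreducible_wrt \<phi> S \<and>
               emeasure \<phi> {w. kernel_Julia S w = {}} > 0))"
  shows "\<not> emptiness_jump S"
  using assms(5)
proof
  assume discrete: "\<forall>U :: 'w set. open U"
  show ?thesis
  proof
    assume "emptiness_jump S"
    then obtain w \<omega> v
      where lim: "(\<lambda>n. act S w (initial n \<omega>)) \<longlonglongrightarrow> v"
        and empty: "\<forall>n\<ge>1. kernel_Julia S (act S w (initial n \<omega>)) = {}"
        and nonempty: "kernel_Julia S v \<noteq> {}"
      unfolding emptiness_jump_def by blast
    \<comment> \<open>The index must be at least 1: a jump leaves the kernel Julia set at the
      starting state unconstrained.\<close>
    have "\<forall>\<^sub>F n in sequentially. act S w (initial n \<omega>) = v \<and> n \<ge> 1"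
      using eventually_eq_limit_if_discrete[OF lim] discrete eventually_ge_at_top
      by (auto intro: eventually_conj)
    then obtain n where "act S w (initial n \<omega>) = v" "n \<ge> 1"
      by (auto simp: eventually_sequentially)
    with empty nonempty show False by blast
  qed
next
  assume A: "{w. kernel_Julia S w = {}} \<in> sets (states S) \<and>
    (\<exists>\<phi>. sets \<phi> = sets (states S) \<and> sigma_finite_measure \<phi> \<and> irreducible_wrt \<phi> S \<and>
      emeasure \<phi> {w. kernel_Julia S w = {}} > 0)"
  have "kernel_Julia S w = {}" for w
  proof -
    have "hitting_prob S w {w. kernel_Julia S w = {}} > 0"
      using A unfolding irreducible_wrt_def by blast
    from Reach_if_hitting_prob_pos[OF assms(2,3) this] show ?thesis
      using kernel_Julia_empty_if_reaches_empty[OF assms(2,3)] by blast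
  qed
  \<comment> \<open>A jump needs a limit state with nonempty kernel Julia set, and none
    exists.\<close>
  then show ?thesis
    by (simp add: emptiness_jump_def)
qed

end
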